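(* Let $V=(v_{ij})\in\mathbb{R}_{\ge 0}^{n\times n}$ be a valuation matrix, let $X$ be the permutation matrix of a maximum weight perfect matching for $V$, and let $V'=X^TV$. Then the procedure PricesEFPM applied to $V'$ returns an envy-free price vector $\mathbf{p}$ that maximizes the seller's revenue in the envy-free perfect matching problem with valuation matrix $V$.
   Context: Envy-free perfect matching problem: there are $n$ consumers and $n$ distinct items, both indexed by $I=\{1,\ldots,n\}$, each item with a single unit available, and each consumer buys exactly one item, so an allocation is a bijection (perfect matching) $\sigma$ from consumers to items. Consumer $i$ values item $j$ at $v_{ij}\ge 0$. A price vector is $\mathbf{p}=(p_1,\ldots,p_n)\in\mathbb{R}_{\ge 0}^n$; the utility of consumer $i$ for item $j$ is $v_{ij}-p_j$, and buying nothing gives utility $0$. The demand set of consumer $i$ consists of the options (single items or nothing) of maximum utility for $i$. An allocation is envy-free for $\mathbf{p}$ if every consumer receives an item from their demand set, i.e. $v_{i\sigma(i)}-p_{\sigma(i)}\ge v_{ij}-p_j$ for all items $j$ and $v_{i\sigma(i)}-p_{\sigma(i)}\ge 0$. A price vector is envy-free if it is nonnegative and admits an envy-free allocation. The seller's revenue is $\sum_{j=1}^n p_j$, to be maximized over all envy-free price vectors and corresponding envy-free allocations. Maximum weight perfect matching: a permutation matrix $X$ ($x_{ij}=1$ meaning consumer $i$ is assigned item $j$) maximizing $\mathrm{tr}(X^TV)$ over all $n\times n$ permutation matrices. Procedure PricesEFPM (input $V'=(v'_{ij})$): 1. Construct $\mathcal{U}=(u_{ij})$ with $u_{ij}=v'_{ij}-v'_{jj}$.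 2. Set $\mathbf{y}^{(0)}=(0,\ldots,0)$. 3. Set $y_j^{(1)}=\max_{k\in I}u_{jk}$ for all $j\in I$, and $t=1$. 4. While $y_j^{(t)}>y_j^{(t-1)}$ for some $j\in I$: compute $y_j^{(t+1)}=\max_{k\in I}\{y_k^{(t)}+u_{jk}\}$ for all $j\in I$, and increase $t$ by $1$. 5. Return the prices $p_j=v'_{jj}-y_j^{(t)}$, $j\in I$ (with the final value of $t$). *)

theory Defs
  imports "HOL-Analysis.Analysis" "HOL-Library.While_Combinator"
begin

text \<open>
  Consumers and items are both indexed by the finite type \<open>'n\<close>. In a valuation matrix rows are
  consumers and columns are items: \<open>V $ i $ j\<close> is the value of item \<open>j\<close> for consumer \<open>i\<close>.
\<close>

text \<open>The option \<open>None\<close> stands for buying nothing.\<close>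

fun utility :: "real^'n^'n \<Rightarrow> real^'n \<Rightarrow> 'n \<Rightarrow> 'n option \<Rightarrow> real" where
  "utility V p i None = 0"
| "utility V p i (Some j) = V $ i $ j - p $ j"

definition demand_set :: "real^'n^'n \<Rightarrow> real^'n \<Rightarrow> 'n \<Rightarrow> 'n option set" where
  "demand_set V p i = {c. \<forall>c'. utility V p i c' \<le> utility V p i c}"

definition envy_free_allocation :: "real^'n^'n \<Rightarrow> real^'n \<Rightarrow> ('n \<Rightarrow> 'n) \<Rightarrow> bool" where
  "envy_free_allocation V p \<sigma> \<longleftrightarrow> bij \<sigma> \<and> (\<forall>i. Some (\<sigma> i) \<in> demand_set V p i)"

definition envy_free_prices :: "real^'n^'n \<Rightarrow> real^'n \<Rightarrow> bool" where
  "envy_free_prices V p \<longleftrightarrow> (\<forall>j. 0 \<le> p $ j) \<and> (\<exists>\<sigma>. envy_free_allocation V p \<sigma>)"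

text \<open>
  All items are sold in a perfect matching, so the revenue does not depend on the allocation.
\<close>

definition revenue :: "real^'n \<Rightarrow> real" where
  "revenue p = (\<Sum>j\<in>UNIV. p $ j)"

text \<open>Entry \<open>(i, j)\<close> is \<open>1\<close> iff consumer \<open>i\<close> is assigned item \<open>j\<close>.\<close>

definition permutation_matrix :: "real^'n^'n \<Rightarrow> bool" where
  "permutation_matrix X \<longleftrightarrow> (\<exists>\<sigma>. bij \<sigma> \<and> X = (\<chi> i j. if j = \<sigma> i then 1 else 0))"

definition max_weight_perfect_matching :: "real^'n^'n \<Rightarrow> real^'n^'n \<Rightarrow> bool" where
  "max_weight_perfect_matching V X \<longleftrightarrow> permutation_matrix X \<and>
     (\<forall>Y. permutation_matrix Y \<longrightarrow> trace (transpose Y ** V) \<le> trace (transpose X ** V))"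

definition EFPM_matrix :: "real^'n^'n \<Rightarrow> real^'n^'n" where
  "EFPM_matrix V' = (\<chi> i j. V' $ i $ j - V' $ j $ j)"

definition EFPM_init :: "real^'n^'n \<Rightarrow> real^'n" where
  "EFPM_init U = (\<chi> j. Max (range (\<lambda>k. U $ j $ k)))"

definition EFPM_step :: "real^'n^'n \<Rightarrow> real^'n \<Rightarrow> real^'n" where
  "EFPM_step U y = (\<chi> j. Max (range (\<lambda>k. y $ k + U $ j $ k)))"

text \<open>
  The loop state is the pair of the two latest iterates \<open>(y\<^sup>(\<^sup>t\<^sup>-\<^sup>1\<^sup>), y\<^sup>(\<^sup>t\<^sup>))\<close>.
  The result is \<open>None\<close> iff the loop does not terminate.
\<close>

definition prices_EFPM :: "real^'n^'n \<Rightarrow> (real^'n) option" where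
  "prices_EFPM V' =
     (let U = EFPM_matrix V' in
      map_option (\<lambda>(y_prev, y). \<chi> j. V' $ j $ j - y $ j)
        (while_option (\<lambda>(y_prev, y). \<exists>j. y $ j > y_prev $ j)
           (\<lambda>(y_prev, y). (y, EFPM_step U y))
           (0, EFPM_init U)))"

end

theory Submission
  imports "HOL-Combinatorics.Cycles" Defs
begin

text \<open>
  The iterate \<open>y\<^sup>(\<^sup>t\<^sup>)\<^sub>j\<close> is the maximal weight of a walk with \<open>t\<close> edges starting at \<open>j\<close>. A closed
  walk decomposes into simple cycles, and the weight of a simple cycle compares the weight of a
  permutation with that of the identity. Optimality of the matching therefore makes all closed walks
  nonpositive; hence shortcutting cycles bounds every walk by a simple one, and the iteration is
  stationary after at most \<open>n\<close> steps. The prices are nonnegative because closing up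
  an optimal walk gives a nonpositive closed walk. Finally, every envy-free price vector
  supports every maximum weight matching, so the associated utilities form a nonnegative
  supersolution of the iteration and dominate its limit: the returned prices are maximal in each
  coordinate.
\<close>

section \<open>Weights of walks\<close>

text \<open>A walk is the list of its vertices. \<open>map2\<close> stops at the shorter
  \<open>tl xs\<close>, so exactly the consecutive vertices are paired.\<close>

definition walk_weight :: "('a \<Rightarrow> 'a \<Rightarrow> real) \<Rightarrow> 'a list \<Rightarrow> real" where
  "walk_weight f xs = sum_list (map2 f xs (tl xs))"

lemma walk_weight_simps [simp]:
  "walk_weight f [] = 0"
  "walk_weight f [x] = 0"
  "walk_weight f (x # y # xs) = f x y + walk_weight f (y # xs)"
  by (simp_all add: walk_weight_def)

text \<open>The cut vertex \<open>x\<close> ends one piece and starts the other, so every edge is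
  counted once.\<close>

lemma walk_weight_append:
  "walk_weight f (xs @ x # ys) = walk_weight f (xs @ [x]) + walk_weight f (x # ys)"
  by (induction xs rule: induct_list012) auto

text \<open>\<open>cycle_of_list\<close> sends each vertex to its successor on the walk and the last
  one back to \<open>x\<close>; this is how cycles become permutations.\<close>

lemma walk_weight_simple_cycle:
  assumes "distinct (x # xs)"
  shows "walk_weight f (x # xs @ [x]) =
    (\<Sum>i\<in>set (x # xs). f i (cycle_of_list (x # xs) i))"
proof -
  let ?c = "cycle_of_list (x # xs)"
  have rot: "map ?c (x # xs) = xs @ [x]"
    using cyclic_rotation[OF assms, of "Suc 0"] by (simp del: cycle_of_list.simps)
  \<comment> \<open>The closing \<open>x\<close> of the longer list has no partner in the
    zip.\<close>
  have "zip (x # xs @ [x]) (xs @ [x]) = zip (x # xs) (xs @ [x])"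
    using zip_append1[of "x # xs" "[x]" "xs @ [x]"] by simp
  also have "\<dots> = zip (x # xs) (map ?c (x # xs))"
    by (simp only: rot)
  finally have "walk_weight f (x # xs @ [x]) = sum_list (map (\<lambda>i. f i (?c i)) (x # xs))"
    unfolding walk_weight_def by (simp add: zip_map2 zip_same_conv_map o_def)
  then show ?thesis
    using assms by (simp only: sum_list_distinct_conv_sum_set)
qed

text \<open>A repeated vertex \<open>y\<close> splits a closed walk into two shorter closed walks
  whose weights add up.\<close>

lemma closed_walk_weight_nonpos:
  assumes simple: "\<And>x xs. distinct (x # xs) \<Longrightarrow> walk_weight f (x # xs @ [x]) \<le> 0"
  shows "walk_weight f (x # xs @ [x]) \<le> 0"
proof (induction "length xs" arbitrary: x xs rule: less_induct)
  case less
  show ?case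
  proof (cases "distinct (x # xs)")
    case True
    then show ?thesis by (rule simple)
  next
    case False
    then obtain as y bs cs where split: "x # xs = as @ [y] @ bs @ [y] @ cs"
      using not_distinct_decomp by blast
    have "length xs + 1 = length as + length bs + length cs + 2"
      using arg_cong[OF split, of length] by simp
    then have "walk_weight f (y # bs @ [y]) \<le> 0"
      by (intro less) simp
    moreover have "walk_weight f (as @ y # cs @ [x]) \<le> 0"
    proof (cases as)
      \<comment> \<open>The repeated vertex is the base point itself, and the remainder is a closed
        walk based at \<open>y\<close>.\<close>
      case Nil
      with split have "x = y" by simp
      moreover have "length cs < length xs" using split Nil by simp
      ultimately show ?thesis using less[of cs y] Nil by simp
    next
      case (Cons a as')
      with split have "a = x" "length (as' @ y # cs) < length xs" by auto
      then show ?thesis using less[of "as' @ y # cs" x] Cons by simp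
    qed
    moreover have walk_eq: "x # xs @ [x] = as @ y # bs @ y # cs @ [x]"
      using arg_cong[OF split, of "\<lambda>zs. zs @ [x]"] by simp
    ultimately show ?thesis
      unfolding walk_eq
      using walk_weight_append[of f as y "bs @ y # cs @ [x]"]
        walk_weight_append[of f "y # bs" y "cs @ [x]"]
        walk_weight_append[of f as y "cs @ [x]"] by simp
  qed
qed

text \<open>Excising the closed walk between two visits to \<open>y\<close> removes a nonpositive
  weight, so the walk gets shorter without becoming lighter.\<close>

lemma walk_weight_le_distinct:
  assumes closed: "\<And>x xs. walk_weight f (x # xs @ [x]) \<le> 0"
  shows "\<exists>ys. distinct (x # ys) \<and> walk_weight f (x # xs) \<le> walk_weight f (x # ys)"
proof (induction "length xs" arbitrary: xs rule: less_induct)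
  case less
  show ?case
  proof (cases "distinct (x # xs)")
    case False
    then obtain as y bs cs where split: "x # xs = as @ [y] @ bs @ [y] @ cs"
      using not_distinct_decomp by blast
    \<comment> \<open>The start stays \<open>x\<close> even for empty \<open>as\<close>, since then
      \<open>y = x\<close>.\<close>
    then obtain zs where zs: "as @ y # cs = x # zs"
      by (cases as) auto
    have "length zs < length xs"
      using arg_cong[OF split, of length] arg_cong[OF zs, of length] by simp
    moreover have "walk_weight f (x # xs) \<le> walk_weight f (x # zs)"
      using closed[of y bs] split zs[symmetric] walk_weight_append[of f as y "bs @ y # cs"]
        walk_weight_append[of f "y # bs" y cs] walk_weight_append[of f as y cs] by simp
    ultimately show ?thesis using less[of zs] by force
  qed auto
qed

section \<open>The value iteration\<close>

lemma EFPM_step_ge: "y $ k + U $ j $ k \<le> EFPM_step U y $ j"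
  by (simp add: EFPM_step_def)

lemma EFPM_step_attained: "\<exists>k. EFPM_step U y $ j = y $ k + U $ j $ k"
proof -
  have "Max (range (\<lambda>k. y $ k + U $ j $ k)) \<in> range (\<lambda>k. y $ k + U $ j $ k)"
    by (rule Max_in) auto
  then show ?thesis unfolding EFPM_step_def vec_lambda_beta by blast
qed

text \<open>Makes all iterates of the procedure powers of \<open>EFPM_step U\<close> applied to
  \<open>0\<close>.\<close>

lemma EFPM_init_eq_step: "EFPM_init U = EFPM_step U 0"
  by (simp add: EFPM_init_def EFPM_step_def)

abbreviation EFPM_iter :: "real^'n^'n \<Rightarrow> nat \<Rightarrow> real^'n" where
  "EFPM_iter U t \<equiv> (EFPM_step U ^^ t) 0"

lemma walk_weight_le_EFPM_iter:
  "walk_weight (\<lambda>i j. U $ i $ j) (j # xs) \<le> EFPM_iter U (length xs) $ j"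
proof (induction xs arbitrary: j)
  case (Cons k xs)
  have "walk_weight (\<lambda>i j. U $ i $ j) (j # k # xs) \<le> EFPM_iter U (length xs) $ k + U $ j $ k"
    using Cons[of k] by simp
  also have "\<dots> \<le> EFPM_iter U (length (k # xs)) $ j"
    using EFPM_step_ge by simp
  finally show ?case .
qed simp

text \<open>Following a maximizing index through the successive steps traces out a walk.\<close>

lemma EFPM_iter_attained:
  "\<exists>xs. EFPM_iter U t $ j = walk_weight (\<lambda>i j. U $ i $ j) (j # xs)"
proof (induction t arbitrary: j)
  case 0
  show ?case by (rule exI[of _ "[]"]) simp
next
  case (Suc t)
  obtain k where k: "EFPM_iter U (Suc t) $ j = EFPM_iter U t $ k + U $ j $ k"
    using EFPM_step_attained[of U "EFPM_iter U t" j] by auto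
  obtain xs where "EFPM_iter U t $ k = walk_weight (\<lambda>i j. U $ i $ j) (k # xs)"
    using Suc by blast
  with k have "EFPM_iter U (Suc t) $ j = walk_weight (\<lambda>i j. U $ i $ j) (j # k # xs)"
    by simp
  then show ?case by blast
qed

text \<open>A zero diagonal makes \<open>k = j\<close> a candidate of value \<open>y $ j\<close> in
  the maximum: waiting at a vertex is free.\<close>

lemma EFPM_iter_mono:
  assumes diag: "\<And>j. U $ j $ j = 0" and "s \<le> t"
  shows "EFPM_iter U s $ j \<le> EFPM_iter U t $ j"
proof (rule lift_Suc_mono_le[of "\<lambda>t. EFPM_iter U t $ j", OF _ \<open>s \<le> t\<close>])
  show "EFPM_iter U t $ j \<le> EFPM_iter U (Suc t) $ j" for t
    using EFPM_step_ge[of "EFPM_iter U t" j U j] by (simp add: diag)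
qed

text \<open>A walk with distinct vertices has fewer than \<open>CARD('n')\<close> edges, so iterate
  number \<open>CARD('n')\<close> already accounts for it.\<close>

lemma EFPM_iter_stationary:
  fixes U :: "real^'n^'n"
  assumes diag: "\<And>j. U $ j $ j = 0"
    and closed: "\<And>x xs. walk_weight (\<lambda>i j. U $ i $ j) (x # xs @ [x]) \<le> 0"
  shows "EFPM_iter U t $ j \<le> EFPM_iter U CARD('n) $ j"
proof -
  obtain xs where xs: "EFPM_iter U t $ j = walk_weight (\<lambda>i j. U $ i $ j) (j # xs)"
    using EFPM_iter_attained by blast
  obtain ys where ys: "distinct (j # ys)"
    "walk_weight (\<lambda>i j. U $ i $ j) (j # xs) \<le> walk_weight (\<lambda>i j. U $ i $ j) (j # ys)"
    using walk_weight_le_distinct[OF closed] by blast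
  have "length (j # ys) \<le> CARD('n)"
    using distinct_card[OF ys(1)] card_mono[of UNIV "set (j # ys)"] by simp
  then have "EFPM_iter U (length ys) $ j \<le> EFPM_iter U CARD('n) $ j"
    by (intro EFPM_iter_mono[OF diag]) simp
  with xs ys(2) walk_weight_le_EFPM_iter[of U j ys] show ?thesis by linarith
qed

text \<open>Comparison principle: the zero start lies below \<open>z\<close>, and each step
  preserves this because it attains its maximum at some \<open>k\<close>.\<close>

lemma EFPM_iter_le_supersolution:
  assumes "\<And>j. 0 \<le> z $ j" and "\<And>j k. z $ k + U $ j $ k \<le> z $ j"
  shows "EFPM_iter U t $ j \<le> z $ j"
proof (induction t arbitrary: j)
  case (Suc t)
  obtain k where "EFPM_step U (EFPM_iter U t) $ j = EFPM_iter U t $ k + U $ j $ k"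
    using EFPM_step_attained by blast
  with Suc[of k] assms(2)[of k j] show ?case by simp
qed (use assms in simp)

lemma prices_EFPM_eq_iter:
  fixes W :: "real^'n^'n"
  defines "U \<equiv> EFPM_matrix W"
  assumes closed: "\<And>x xs. walk_weight (\<lambda>i j. U $ i $ j) (x # xs @ [x]) \<le> 0"
  shows "\<exists>t. prices_EFPM W = Some (\<chi> j. W $ j $ j - EFPM_iter U t $ j) \<and>
    EFPM_step U (EFPM_iter U t) = EFPM_iter U t"
proof -
  let ?b = "\<lambda>(y_prev :: real^'n, y :: real^'n). \<exists>j. y $ j > y_prev $ j"
  let ?c = "\<lambda>(y_prev :: real^'n, y). (y, EFPM_step U y)"
  let ?s = "(0, EFPM_init U)"
  have diag: "U $ j $ j = 0" for j
    by (simp add: U_def EFPM_matrix_def)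
  have state: "(?c ^^ k) ?s = (EFPM_iter U k, EFPM_iter U (Suc k))" for k
    by (induction k) (simp_all add: EFPM_init_eq_step)
  \<comment> \<open>After \<open>CARD('n')\<close> rounds the pair holds iterates
    \<open>CARD('n')\<close> and \<open>CARD('n') + 1\<close>, and the latter cannot exceed the
    former. So some state fails the guard, and \<open>while_option\<close> stops at the first
    one.\<close>
  have "\<not> ?b ((?c ^^ CARD('n)) ?s)"
    unfolding state using EFPM_iter_stationary[OF diag closed]
    by (simp add: not_less del: funpow.simps)
  then obtain k where k: "while_option ?b ?c ?s = Some ((?c ^^ k) ?s)" "\<not> ?b ((?c ^^ k) ?s)"
    unfolding while_option_def by (metis (mono_tags, lifting) LeastI)
  \<comment> \<open>The failed guard gives one inequality, monotonicity the other.\<close>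
  have "EFPM_iter U (Suc k) $ j = EFPM_iter U k $ j" for j
    using k(2) EFPM_iter_mono[OF diag, of k "Suc k" j] unfolding state
    by (auto simp: not_less simp del: funpow.simps intro: antisym)
  then have fix_eq: "EFPM_iter U (Suc k) = EFPM_iter U k"
    by (simp add: vec_eq_iff)
  have "prices_EFPM W = Some (\<chi> j. W $ j $ j - EFPM_iter U (Suc k) $ j)"
    using k(1) unfolding prices_EFPM_def Let_def U_def[symmetric] state by simp
  \<comment> \<open>The loop returns iterate \<open>Suc k\<close>, which equals iterate
    \<open>k\<close>, the witness for \<open>t\<close>.\<close>
  then show ?thesis
    using fix_eq by (intro exI[of _ k]) (simp only: funpow.simps o_apply)
qed

section \<open>Envy-free allocations\<close>

lemma envy_free_allocation_iff:
  "envy_free_allocation V p \<sigma> \<longleftrightarrow> bij \<sigma> \<and>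
    (\<forall>i. p $ \<sigma> i \<le> V $ i $ \<sigma> i) \<and> (\<forall>i j. V $ i $ j - p $ j \<le> V $ i $ \<sigma> i - p $ \<sigma> i)"
proof -
  have "Some k \<in> demand_set V p i \<longleftrightarrow>
      p $ k \<le> V $ i $ k \<and> (\<forall>j. V $ i $ j - p $ j \<le> V $ i $ k - p $ k)" for i k
    unfolding demand_set_def mem_Collect_eq split_option_all utility.simps by simp
  then show ?thesis by (simp only: envy_free_allocation_def all_conj_distrib)
qed

text \<open>Along a cycle the subtracted diagonal entries are merely permuted, so its weight is the
  matching weight of the cycle permutation minus that of the identity.\<close>

lemma closed_walk_weight_EFPM_matrix:
  fixes W :: "real^'n^'n"
  assumes opt: "\<And>\<pi>. bij \<pi> \<Longrightarrow> (\<Sum>i\<in>UNIV. W $ i $ \<pi> i) \<le> (\<Sum>i\<in>UNIV. W $ i $ i)"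
  shows "walk_weight (\<lambda>i j. EFPM_matrix W $ i $ j) (x # xs @ [x]) \<le> 0"
proof (rule closed_walk_weight_nonpos)
  fix x :: 'n and xs
  assume dist: "distinct (x # xs)"
  let ?c = "cycle_of_list (x # xs)" and ?S = "set (x # xs)"
  have perm: "?c permutes ?S" by (rule cycle_permutes)
  then have "bij ?c" by (rule permutes_bij)
  have "walk_weight (\<lambda>i j. EFPM_matrix W $ i $ j) (x # xs @ [x]) =
      (\<Sum>i\<in>?S. W $ i $ ?c i - W $ ?c i $ ?c i)"
    using walk_weight_simple_cycle[OF dist] by (simp only: EFPM_matrix_def vec_lambda_beta)
  \<comment> \<open>Off the cycle \<open>?c\<close> fixes \<open>i\<close>, and the summand
    vanishes.\<close>
  also have "\<dots> = (\<Sum>i\<in>UNIV. W $ i $ ?c i - W $ ?c i $ ?c i)"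
    using permutes_not_in[OF perm] by (intro sum.mono_neutral_left) auto
  also have "\<dots> = (\<Sum>i\<in>UNIV. W $ i $ ?c i) - (\<Sum>i\<in>UNIV. W $ i $ i)"
    using sum.reindex_bij_betw[OF \<open>bij ?c\<close>, of "\<lambda>i. W $ i $ i"] by (simp only: sum_subtractf)
  also have "\<dots> \<le> 0"
    using opt[OF \<open>bij ?c\<close>] by simp
  finally show "walk_weight (\<lambda>i j. EFPM_matrix W $ i $ j) (x # xs @ [x]) \<le> 0" .
qed

text \<open>The limit \<open>y $ j\<close> is the utility of consumer \<open>j\<close> for item
  \<open>j\<close>: its fixed-point inequality is envy-freeness, and \<open>0 \<le> y $ j\<close>
  makes buying no worse than not buying.\<close>

lemma prices_EFPM_identity_optimal:
  fixes W :: "real^'n^'n"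
  assumes nonneg: "\<And>i j. 0 \<le> W $ i $ j"
    and opt: "\<And>\<pi>. bij \<pi> \<Longrightarrow> (\<Sum>i\<in>UNIV. W $ i $ \<pi> i) \<le> (\<Sum>i\<in>UNIV. W $ i $ i)"
  shows "\<exists>p. prices_EFPM W = Some p \<and> (\<forall>j. 0 \<le> p $ j) \<and> envy_free_allocation W p id \<and>
    (\<forall>q. envy_free_allocation W q id \<longrightarrow> (\<forall>j. q $ j \<le> p $ j))"
proof -
  define U where "U = EFPM_matrix W"
  have U: "U $ i $ j = W $ i $ j - W $ j $ j" for i j
    by (simp add: U_def EFPM_matrix_def)
  have closed: "walk_weight (\<lambda>i j. U $ i $ j) (x # xs @ [x]) \<le> 0" for x xs
    unfolding U_def using opt by (rule closed_walk_weight_EFPM_matrix)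
  obtain t where t: "prices_EFPM W = Some (\<chi> j. W $ j $ j - EFPM_iter U t $ j)"
    "EFPM_step U (EFPM_iter U t) = EFPM_iter U t"
    using prices_EFPM_eq_iter[of W] closed unfolding U_def by blast
  define y where "y = EFPM_iter U t"
  have y_nonneg: "0 \<le> y $ j" for j
    using EFPM_iter_mono[of U 0 t j] by (simp add: y_def U)
  have y_super: "y $ k + U $ j $ k \<le> y $ j" for j k
    using EFPM_step_ge[of y k U j] t(2) by (simp add: y_def)
  have y_le: "y $ j \<le> W $ j $ j" for j
  proof -
    obtain xs where xs: "y $ j = walk_weight (\<lambda>i j. U $ i $ j) (j # xs)"
      unfolding y_def using EFPM_iter_attained by blast
    \<comment> \<open>Returning from the end \<open>l\<close> of the walk to \<open>j\<close> gives
      \<open>y $ j \<le> - U $ l $ j = W $ j $ j - W $ l $ j\<close>, and valuations are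
      nonnegative.\<close>
    define l where "l = last (j # xs)"
    have "walk_weight (\<lambda>i j. U $ i $ j) (j # xs @ [j]) = y $ j + U $ l $ j"
      using walk_weight_append[of "\<lambda>i j. U $ i $ j" "butlast (j # xs)" l "[j]"] xs
        append_butlast_last_id[of "j # xs"]
      unfolding l_def
      by (metis append.assoc append_Cons append_Nil list.distinct(1) walk_weight_simps(2,3)
          add.right_neutral)
    with closed[of j xs] nonneg[of l j] show ?thesis by (simp add: U)
  qed
  let ?p = "\<chi> j. W $ j $ j - y $ j"
  have "W $ i $ j - ?p $ j \<le> W $ i $ i - ?p $ i" for i j
    using y_super[of j i] by (simp add: U)
  then have "envy_free_allocation W ?p id"
    using y_nonneg by (simp add: envy_free_allocation_iff)
  moreover have "q $ j \<le> ?p $ j" if q: "envy_free_allocation W q id" for q j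
  proof -
    \<comment> \<open>The utilities \<open>W $ j $ j - q $ j\<close> form a nonnegative
      supersolution because \<open>q\<close> supports the identity.\<close>
    have "y $ j \<le> (\<chi> j. W $ j $ j - q $ j) $ j"
      unfolding y_def
    proof (rule EFPM_iter_le_supersolution)
      show "(\<chi> j. W $ j $ j - q $ j) $ k + U $ i $ k \<le> (\<chi> j. W $ j $ j - q $ j) $ i" for i k
        using q unfolding envy_free_allocation_iff by (simp add: U)
    qed (use q in \<open>simp add: envy_free_allocation_iff\<close>)
    then show ?thesis by simp
  qed
  ultimately show ?thesis
    using t(1) y_le unfolding y_def[symmetric] by simp
qed

text \<open>Both matchings sell every item, so prices cancel in the total utility gap. Each gap is
  nonnegative by envy-freeness of \<open>\<tau>\<close> and their sum is at most zero, so
  \<open>\<sigma>\<close> gives every consumer the same utility as \<open>\<tau>\<close>.\<close>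

lemma envy_free_allocation_max_weight:
  fixes V :: "real^'n^'n"
  assumes \<tau>: "envy_free_allocation V q \<tau>" and "bij \<sigma>"
    and le: "(\<Sum>i\<in>UNIV. V $ i $ \<tau> i) \<le> (\<Sum>i\<in>UNIV. V $ i $ \<sigma> i)"
  shows "envy_free_allocation V q \<sigma>"
proof -
  have "bij \<tau>" and ir: "\<And>i. q $ \<tau> i \<le> V $ i $ \<tau> i"
    and env: "\<And>i j. V $ i $ j - q $ j \<le> V $ i $ \<tau> i - q $ \<tau> i"
    using \<tau> by (auto simp: envy_free_allocation_iff)
  let ?gap = "\<lambda>i. (V $ i $ \<tau> i - q $ \<tau> i) - (V $ i $ \<sigma> i - q $ \<sigma> i)"
  have gap_nonneg: "0 \<le> ?gap i" for i
    using env[of i "\<sigma> i"] by simp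
  have "sum ?gap UNIV = (\<Sum>i\<in>UNIV. V $ i $ \<tau> i) - (\<Sum>i\<in>UNIV. V $ i $ \<sigma> i)"
    using sum.reindex_bij_betw[OF \<open>bij \<tau>\<close>, of "\<lambda>j. q $ j"]
      sum.reindex_bij_betw[OF \<open>bij \<sigma>\<close>, of "\<lambda>j. q $ j"] by (simp add: sum_subtractf)
  with le have "sum ?gap UNIV = 0"
    using sum_nonneg[of UNIV ?gap] gap_nonneg by auto
  then have "?gap i = 0" for i
    using gap_nonneg sum_nonneg_eq_0_iff[of UNIV ?gap] by simp
  then have eq: "V $ i $ \<sigma> i - q $ \<sigma> i = V $ i $ \<tau> i - q $ \<tau> i" for i
    by (metis eq_iff_diff_eq_0)
  have "q $ \<sigma> i \<le> V $ i $ \<sigma> i" for i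
    using eq[of i] ir[of i] by linarith
  with env eq \<open>bij \<sigma>\<close> show ?thesis by (simp add: envy_free_allocation_iff)
qed

section \<open>Matchings as permutation matrices\<close>

text \<open>Row \<open>i\<close> moves to row \<open>\<sigma> i\<close>: each consumer is renamed
  after the item received, which turns the matching \<open>\<sigma>\<close> into the
  identity.\<close>

lemma transpose_permutation_matrix_mult:
  fixes V :: "real^'n^'n"
  assumes "bij \<sigma>"
  shows "(Finite_Cartesian_Product.transpose (\<chi> i j. if j = \<sigma> i then 1 else 0) ** V) $ \<sigma> i $ j
    = V $ i $ j"
proof -
  have "(if \<sigma> i = \<sigma> k then 1 else 0) * V $ k $ j = (if k = i then V $ k $ j else 0)" for k
    using bij_is_inj[OF assms] by (auto simp: inj_eq)
  then show ?thesis
    by (simp add: matrix_matrix_mult_def Finite_Cartesian_Product.transpose_def)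
qed

text \<open>The identity as \<open>\<pi>\<close> yields the trace; a general matching
  \<open>\<pi>\<close> for \<open>W\<close> corresponds to \<open>\<pi> \<circ> \<sigma>\<close> for
  \<open>V\<close>.\<close>

lemma sum_transpose_permutation_matrix_mult:
  fixes V :: "real^'n^'n"
  assumes "bij \<sigma>"
  defines "W \<equiv> Finite_Cartesian_Product.transpose (\<chi> i j. if j = \<sigma> i then 1 else 0) ** V"
  shows "(\<Sum>i\<in>UNIV. W $ i $ \<pi> i) = (\<Sum>i\<in>UNIV. V $ i $ \<pi> (\<sigma> i))"
  using sum.reindex_bij_betw[OF \<open>bij \<sigma>\<close>, of "\<lambda>i. W $ i $ \<pi> i"]
  by (simp add: W_def transpose_permutation_matrix_mult[OF \<open>bij \<sigma>\<close>])

text \<open>Only consumers are renamed; prices belong to items and stay fixed.\<close>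

lemma envy_free_allocation_relabel:
  fixes V W :: "real^'n^'n"
  assumes "bij \<sigma>" and W: "\<And>i j. W $ \<sigma> i $ j = V $ i $ j"
  shows "envy_free_allocation W p id \<longleftrightarrow> envy_free_allocation V p \<sigma>"
proof -
  have reindex: "(\<forall>i. P i) \<longleftrightarrow> (\<forall>i. P (\<sigma> i))" for P
    using bij_is_surj[OF \<open>bij \<sigma>\<close>] by (metis surjD)
  show ?thesis
    using reindex[of "\<lambda>i. p $ i \<le> W $ i $ i"] \<open>bij \<sigma>\<close>
      reindex[of "\<lambda>i. \<forall>j. W $ i $ j - p $ j \<le> W $ i $ i - p $ i"]
    by (simp add: envy_free_allocation_iff W)
qed

theorem theorem3p4:
  fixes V X :: "real^'n^'n"
  assumes "\<And>i j. 0 \<le> V $ i $ j"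
    and "max_weight_perfect_matching V X"
  shows "\<exists>p. prices_EFPM (transpose X ** V) = Some p \<and>
           envy_free_prices V p \<and>
           (\<forall>q. envy_free_prices V q \<longrightarrow> revenue q \<le> revenue p)"
proof -
  obtain \<sigma> where \<sigma>: "bij \<sigma>" and X: "X = (\<chi> i j. if j = \<sigma> i then 1 else 0)"
    using assms(2) by (auto simp: max_weight_perfect_matching_def permutation_matrix_def)
  define W where "W = transpose X ** V"
  have W: "W $ \<sigma> i $ j = V $ i $ j" for i j
    unfolding W_def X using \<sigma> by (rule transpose_permutation_matrix_mult)
  have trace: "trace (transpose (\<chi> i j. if j = \<tau> i then 1 else 0) ** V) =
      (\<Sum>i\<in>UNIV. V $ i $ \<tau> i)" if "bij \<tau>" for \<tau>
    using sum_transpose_permutation_matrix_mult[OF that, of V "\<lambda>i. i"] by (simp add: trace_def)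
  have opt: "(\<Sum>i\<in>UNIV. V $ i $ \<tau> i) \<le> (\<Sum>i\<in>UNIV. V $ i $ \<sigma> i)" if "bij \<tau>" for \<tau>
  proof -
    have "permutation_matrix ((\<chi> i j. if j = \<tau> i then 1 else 0) :: real^'n^'n)"
      using that by (auto simp: permutation_matrix_def)
    with assms(2) show ?thesis
      by (simp add: max_weight_perfect_matching_def X flip: trace[OF that] trace[OF \<sigma>])
  qed
  have "(\<Sum>i\<in>UNIV. W $ i $ \<pi> i) \<le> (\<Sum>i\<in>UNIV. W $ i $ i)" if "bij \<pi>" for \<pi>
    using opt[OF bij_comp[OF \<sigma> that]] sum_transpose_permutation_matrix_mult[OF \<sigma>, of V]
    unfolding W_def X by simp
  moreover have "0 \<le> W $ i $ j" for i j
    using assms(1) W \<sigma> by (metis bij_pointE)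
  ultimately obtain p where p: "prices_EFPM W = Some p" "\<forall>j. 0 \<le> p $ j"
    "envy_free_allocation W p id"
    and max: "\<And>q j. envy_free_allocation W q id \<Longrightarrow> q $ j \<le> p $ j"
    using prices_EFPM_identity_optimal[of W] by blast
  note relabel = envy_free_allocation_relabel[OF \<sigma> W]
  have "envy_free_prices V p"
    using p(2,3) relabel by (auto simp: envy_free_prices_def)
  moreover have "revenue q \<le> revenue p" if q: "envy_free_prices V q" for q
  proof -
    obtain \<tau> where \<tau>: "envy_free_allocation V q \<tau>"
      using q by (auto simp: envy_free_prices_def)
    then have "bij \<tau>" by (simp add: envy_free_allocation_iff)
    \<comment> \<open>Moving \<open>q\<close> to the common matching \<open>\<sigma>\<close> allows
      a comparison with \<open>p\<close> item by item.\<close>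
    then have "envy_free_allocation V q \<sigma>"
      using envy_free_allocation_max_weight[OF \<tau> \<sigma>] opt by blast
    then have "q $ j \<le> p $ j" for j
      using max relabel by blast
    then show ?thesis by (simp add: revenue_def sum_mono)
  qed
  ultimately show ?thesis
    using p(1) by (auto simp: W_def)
qed

end
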